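(* The generating series $\Psi(\xi,t)=\sum_{\nu\ge0}P_\nu(\xi)t^\nu$ and $\Upsilon(\xi,t)=\sum_{\nu\ge0}Q_\nu(\xi)t^\nu$ are given by \[\Psi(\xi,t)=e^{\xi t+t^2/2},\qquad \Upsilon(\xi,t)=e^{(\xi+t)^2/2}\int_\xi^{\xi+t}e^{-w^2/2}dw=e^{\xi t+t^2/2}\int_0^te^{-\xi w-w^2/2}dw.\] They satisfy \[(\partial_t-\xi)\Psi=t\Psi\qquad\text{and}\qquad(\partial_t-\xi)\Upsilon=t\Upsilon+1.\]
   Context: $P_\nu,Q_\nu\in\mathbb{Q}[\xi]$ ($\nu\in\mathbb{N}$) are the unique polynomials with $P_0=1$, $Q_0=0$ and, for $\nu\ge1$, $P_\nu'=P_{\nu-1}$ and $P_\nu+Q_\nu'-\xi Q_\nu=Q_{\nu-1}$. *)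

theory Defs
  imports "HOL-Complex_Analysis.Complex_Analysis" "HOL-Computational_Algebra.Polynomial"
begin

definition PQ_system :: "(nat \<Rightarrow> rat poly) \<Rightarrow> (nat \<Rightarrow> rat poly) \<Rightarrow> bool" where
  "PQ_system P Q \<longleftrightarrow> P 0 = 1 \<and> Q 0 = 0 \<and>
     (\<forall>\<nu>\<ge>1. pderiv (P \<nu>) = P (\<nu> - 1) \<and>
            P \<nu> + pderiv (Q \<nu>) - [:0, 1:] * Q \<nu> = Q (\<nu> - 1))"

lemma degree_pderiv_minus_X_mult:
  fixes q :: "rat poly"
  assumes "q \<noteq> 0"
  shows "degree (pderiv q - [:0, 1:] * q) = Suc (degree q)"
proof -
  have "degree ([:0, 1:] * q) = Suc (degree q)"
    using assms by simp
  moreover have "degree (pderiv q) < Suc (degree q)"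
    by (simp add: degree_pderiv)
  ultimately show ?thesis
    by (metis degree_add_eq_right degree_minus diff_conv_add_uminus)
qed

lemma ex_antiderivative:
  fixes p :: "rat poly"
  shows "\<exists>r. pderiv r = p"
proof
  define r where "r = (\<Sum>i\<le>degree p. monom (coeff p i / of_nat (Suc i)) (Suc i))"
  have "pderiv r = (\<Sum>i\<le>degree p. monom (coeff p i) i)"
    unfolding r_def higher_pderiv_sum[of 1, simplified]
    by (intro sum.cong refl) (simp add: pderiv_monom del: of_nat_Suc)
  then show "pderiv r = p"
    by (simp add: poly_as_sum_of_monoms)
qed

lemma ex_pderiv_minus_X_mult:
  fixes r :: "rat poly"
  shows "\<exists>q c. pderiv q - [:0, 1:] * q = r + [:c:]"
proof (induction "degree r" arbitrary: r rule: less_induct)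
  case less
  show ?case
  proof (cases "degree r = 0")
    case True
    then obtain a where "r = [:a:]" by (metis degree_eq_zeroE)
    then show ?thesis by (intro exI[of _ 0] exI[of _ "- a"]) simp
  next
    case False
    define n where "n = degree r - 1"
    define m where "m = monom (- lead_coeff r) n"
    define s where "s = r - (pderiv m - [:0, 1:] * m)"
    have n: "degree r = Suc n" using False by (simp add: n_def)
    have "lead_coeff r \<noteq> 0" using False by auto
    then have m: "degree m = n" "m \<noteq> 0"
      by (simp_all add: m_def degree_monom_eq monom_eq_0_iff)
    have "degree (pderiv m - [:0, 1:] * m) = Suc n"
      using degree_pderiv_minus_X_mult[OF m(2)] m by simp
    then have "degree s \<le> Suc n"
      unfolding s_def using n by (metis degree_diff_le order.refl)
    moreover have "coeff s (Suc n) = 0"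
      using m n by (simp add: s_def coeff_pderiv m_def)
    ultimately have "degree s < degree r"
      using n by (metis degree_0 eq_zero_or_degree_less less_Suc_eq_le zero_less_Suc)
    from less[OF this] obtain q c where "pderiv q - [:0, 1:] * q = s + [:c:]" by blast
    then have "pderiv (q + m) - [:0, 1:] * (q + m) = r + [:c:]"
      by (simp add: s_def pderiv_add algebra_simps)
    then show ?thesis by blast
  qed
qed

lemma PQ_step_unique:
  fixes p p' q q' :: "rat poly"
  assumes "pderiv p = pderiv p'"
    and "p + pderiv q - [:0, 1:] * q = p' + pderiv q' - [:0, 1:] * q'"
  shows "p = p' \<and> q = q'"
proof -
  have "pderiv (p' - p) = 0" using assms by (simp add: pderiv_diff)
  then have d: "degree (p' - p) = 0" by (simp add: pderiv_eq_0_iff)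
  have e: "pderiv (q - q') - [:0, 1:] * (q - q') = p' - p"
    using assms(2) unfolding pderiv_diff by algebra
  have "q - q' = 0"
    using degree_pderiv_minus_X_mult[of "q - q'"] d e by force
  then show ?thesis using e by simp
qed

lemma PQ_system_ex1: "\<exists>!PQ. PQ_system (fst PQ) (snd PQ)"
proof -
  have step: "\<exists>y :: rat poly \<times> rat poly. pderiv (fst y) = fst x \<and>
      fst y + pderiv (snd y) - [:0, 1:] * snd y = snd x" for x
  proof -
    obtain r where r: "pderiv r = fst x" using ex_antiderivative by blast
    obtain q c where "pderiv q - [:0, 1:] * q = (snd x - r) + [:c:]"
      using ex_pderiv_minus_X_mult by blast
    then show ?thesis
      using r by (intro exI[of _ "(r - [:c:], q)"]) (simp add: pderiv_diff algebra_simps)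
  qed
  obtain f :: "nat \<Rightarrow> rat poly \<times> rat poly" where f: "f 0 = (1, 0)"
    "\<And>n. pderiv (fst (f (Suc n))) = fst (f n) \<and>
      fst (f (Suc n)) + pderiv (snd (f (Suc n))) - [:0, 1:] * snd (f (Suc n)) = snd (f n)"
    using dependent_nat_choice[where P = "\<lambda>n y. n = 0 \<longrightarrow> y = (1, 0)" and
        Q = "\<lambda>n x y. pderiv (fst y) = fst x \<and>
          fst y + pderiv (snd y) - [:0, 1:] * snd y = (snd x :: rat poly)"] step
    by auto
  have ex: "PQ_system (fst \<circ> f) (snd \<circ> f)"
    unfolding PQ_system_def
  proof (intro conjI allI impI)
    fix \<nu> :: nat assume "1 \<le> \<nu>"
    then obtain n where "\<nu> = Suc n" by (cases \<nu>) auto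
    then show "pderiv ((fst \<circ> f) \<nu>) = (fst \<circ> f) (\<nu> - 1)"
      and "(fst \<circ> f) \<nu> + pderiv ((snd \<circ> f) \<nu>) - [:0, 1:] * (snd \<circ> f) \<nu> = (snd \<circ> f) (\<nu> - 1)"
      using f(2)[of n] by simp_all
  qed (simp_all add: f(1))
  have uniq: "P n = P' n \<and> Q n = Q' n" if "PQ_system P Q" "PQ_system P' Q'" for P Q P' Q' n
  proof (induction n)
    case 0
    then show ?case using that by (simp add: PQ_system_def)
  next
    case (Suc n)
    have "1 \<le> Suc n" "Suc n - 1 = n" by simp_all
    then show ?case
      using that Suc unfolding PQ_system_def by (intro PQ_step_unique) metis+
  qed
  show ?thesis
  proof (rule ex1I[of _ "(fst \<circ> f, snd \<circ> f)"])
    show "PQ_system (fst (fst \<circ> f, snd \<circ> f)) (snd (fst \<circ> f, snd \<circ> f))" using ex by simp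
    fix PQ assume "PQ_system (fst PQ) (snd PQ)"
    then show "PQ = (fst \<circ> f, snd \<circ> f)"
      using uniq[OF _ ex] by (intro prod_eqI ext) auto
  qed
qed

definition PQ_pair :: "(nat \<Rightarrow> rat poly) \<times> (nat \<Rightarrow> rat poly)" where
  "PQ_pair = (THE PQ. PQ_system (fst PQ) (snd PQ))"

definition P_poly :: "nat \<Rightarrow> rat poly" where
  "P_poly = fst PQ_pair"

definition Q_poly :: "nat \<Rightarrow> rat poly" where
  "Q_poly = snd PQ_pair"

lemma PQ_system_P_poly_Q_poly: "PQ_system P_poly Q_poly"
  unfolding P_poly_def Q_poly_def PQ_pair_def by (rule theI'[OF PQ_system_ex1])

definition Psi_term :: "complex \<Rightarrow> complex \<Rightarrow> nat \<Rightarrow> complex" where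
  "Psi_term \<xi> t \<nu> = poly (map_poly of_rat (P_poly \<nu>)) \<xi> * t ^ \<nu>"

definition Upsilon_term :: "complex \<Rightarrow> complex \<Rightarrow> nat \<Rightarrow> complex" where
  "Upsilon_term \<xi> t \<nu> = poly (map_poly of_rat (Q_poly \<nu>)) \<xi> * t ^ \<nu>"

text \<open>Since \<open>suminf\<close> is total, these are the generating series only where the terms are
  summable.\<close>

definition Psi :: "complex \<Rightarrow> complex \<Rightarrow> complex" where
  "Psi \<xi> t = (\<Sum>\<nu>. Psi_term \<xi> t \<nu>)"

definition Upsilon :: "complex \<Rightarrow> complex \<Rightarrow> complex" where
  "Upsilon \<xi> t = (\<Sum>\<nu>. Upsilon_term \<xi> t \<nu>)"

end

theory Submission
  imports Defs
begin

text \<open>The uniqueness of one step of the system (lemma \<open>PQ_step_unique\<close>) yields, by induction, the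
  three-term recurrences \<open>(n + 2) P\<^sub>n\<^sub>+\<^sub>2 = \<xi> P\<^sub>n\<^sub>+\<^sub>1 + P\<^sub>n\<close> and the same for \<open>Q\<close>, with \<open>P\<^sub>1 = \<xi>\<close> and
  \<open>Q\<^sub>1 = 1\<close>. These are exactly the recurrences for the Taylor coefficients at \<open>0\<close> of an entire
  solution of \<open>f' = (\<xi> + t) f + c\<close>, with \<open>c = 0\<close> and \<open>c = 1\<close> respectively, and the closed forms
  are such solutions.\<close>

text \<open>The pair \<open>([:0, 1:], 1)\<close> solves the step equations out of
  \<open>(1, 0)\<close>: the derivative of \<xi> is 1, and \<xi> + 0 - \<xi> * 1 = 0. Uniqueness of
  the step does the rest.\<close>

lemma PQ_system_1:
  assumes "PQ_system P Q"
  shows "P 1 = [:0, 1:] \<and> Q 1 = 1"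
proof (rule PQ_step_unique)
  show "pderiv (P 1) = pderiv [:0, 1:]"
    using assms by (simp add: PQ_system_def pderiv_pCons)
  show "P 1 + pderiv (Q 1) - [:0, 1:] * Q 1 = [:0, 1:] + pderiv 1 - [:0, 1:] * 1"
    using assms by (simp add: PQ_system_def)
qed

text \<open>The two sides, taken as pairs of polynomials, solve the same step equations. In the
  inductive step the product rule applied to \<xi> contributes one extra copy of
  \<open>P (n + 2)\<close> or \<open>Q (n + 2)\<close>; the induction hypothesis contracts the
  remaining terms to n + 2 copies, and the total n + 3 is what the left side gives.\<close>

lemma PQ_system_recurrence:
  assumes "PQ_system P Q"
  shows "of_nat (n + 2) * P (n + 2) = [:0, 1:] * P (n + 1) + P n \<and>
    of_nat (n + 2) * Q (n + 2) = [:0, 1:] * Q (n + 1) + Q n"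
proof (induction n)
  case 0
  have d: "P 0 = 1" "Q 0 = 0" "P 1 = [:0, 1:]" "Q 1 = 1"
    "pderiv (P 2) = P 1" "P 2 + pderiv (Q 2) - [:0, 1:] * Q 2 = Q 1"
    using assms PQ_system_1[OF assms] by (auto simp: PQ_system_def)
  \<comment> \<open>With no earlier recurrence to use, both sides are computed: the step equations
    send each pair to 2 \<xi> and 2.\<close>
  have "2 * P 2 = [:0, 1:] * P 1 + P 0 \<and> 2 * Q 2 = [:0, 1:] * Q 1 + Q 0"
  proof (rule PQ_step_unique)
    have "pderiv (2 * P 2) = 2 * pderiv (P 2)"
      by (simp add: pderiv_mult)
    then show "pderiv (2 * P 2) = pderiv ([:0, 1:] * P 1 + P 0)"
      using d by (simp add: pderiv_add pderiv_mult pderiv_pCons numeral_poly one_pCons)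
    have "2 * P 2 + pderiv (2 * Q 2) - [:0, 1:] * (2 * Q 2)
        = 2 * (P 2 + pderiv (Q 2) - [:0, 1:] * Q 2)"
      by (simp add: pderiv_mult algebra_simps)
    also have "\<dots> = 2" using d by simp
    also have "\<dots> = [:0, 1:] * P 1 + P 0 + pderiv ([:0, 1:] * Q 1 + Q 0)
        - [:0, 1:] * ([:0, 1:] * Q 1 + Q 0)"
      using d by (simp add: pderiv_add pderiv_mult pderiv_pCons numeral_poly one_pCons)
    finally show "2 * P 2 + pderiv (2 * Q 2) - [:0, 1:] * (2 * Q 2) = \<dots>" .
  qed
  then show ?case by (simp add: numeral_2_eq_2)
next
  case (Suc n)
  let ?X = "[:0, 1:] :: rat poly" and ?k = "of_nat (n + 2) :: rat poly"
  have dP: "pderiv (P (Suc m)) = P m"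
    and dQ: "P (Suc m) + pderiv (Q (Suc m)) - ?X * Q (Suc m) = Q m" for m
    using assms unfolding PQ_system_def by (metis diff_Suc_1 le_add1 plus_1_eq_Suc)+
  have dX: "pderiv ?X = 1" by (simp add: pderiv_pCons)
  have dk: "pderiv (?k + 1) = 0"
    by (metis of_nat_1 of_nat_add pderiv_of_nat)
  have IH: "?k * P (n + 2) = ?X * P (n + 1) + P n" "?k * Q (n + 2) = ?X * Q (n + 1) + Q n"
    using Suc by simp_all
  have d: "pderiv (P (n + 3)) = P (n + 2)" "pderiv (P (n + 2)) = P (n + 1)"
    "pderiv (P (n + 1)) = P n"
    "P (n + 3) + pderiv (Q (n + 3)) - ?X * Q (n + 3) = Q (n + 2)"
    "P (n + 2) + pderiv (Q (n + 2)) - ?X * Q (n + 2) = Q (n + 1)"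
    "P (n + 1) + pderiv (Q (n + 1)) - ?X * Q (n + 1) = Q n"
    using dP[of "n+2"] dP[of "n+1"] dP[of n] dQ[of "n+2"] dQ[of "n+1"] dQ[of n]
    by (simp_all add: numeral_2_eq_2 numeral_3_eq_3)
  have "(?k + 1) * P (n + 3) = ?X * P (n + 2) + P (n + 1) \<and>
    (?k + 1) * Q (n + 3) = ?X * Q (n + 2) + Q (n + 1)"
  proof (rule PQ_step_unique)
    show "pderiv ((?k + 1) * P (n + 3)) = pderiv (?X * P (n + 2) + P (n + 1))"
      unfolding pderiv_add[of "?X * P (n + 2)"] pderiv_mult dk dX
      using IH d by algebra
    show "(?k + 1) * P (n + 3) + pderiv ((?k + 1) * Q (n + 3)) - ?X * ((?k + 1) * Q (n + 3)) =
        ?X * P (n + 2) + P (n + 1) + pderiv (?X * Q (n + 2) + Q (n + 1))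
        - ?X * (?X * Q (n + 2) + Q (n + 1))"
      unfolding pderiv_add[of "?X * Q (n + 2)"] pderiv_mult dk dX
      using IH d by algebra
  qed
  moreover have "Suc n + 2 = n + 3" "Suc n + 1 = n + 2" "Suc n = n + 1" "of_nat (Suc n + 2) = ?k + 1"
    by simp_all
  ultimately show ?case by metis
qed

lemma map_poly_of_rat_add:
  "map_poly of_rat (p + q) = map_poly of_rat p + (map_poly of_rat q :: 'a::field_char_0 poly)"
  by (rule poly_eqI) (simp add: coeff_map_poly of_rat_add)

lemma map_poly_of_rat_smult:
  "map_poly of_rat (smult c p) = smult (of_rat c) (map_poly of_rat p :: 'a::field_char_0 poly)"
  by (rule map_poly_smult) (simp_all add: of_rat_mult)

text \<open>This is the Leibniz rule for the equation differentiated n + 1 times: the factor \<xi> +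
  t has vanishing second derivative, so only two terms survive, and the constant \<open>c\<close>
  disappears at the first differentiation. The point \<open>t\<close> stays arbitrary in the
  induction because the identity is itself differentiated.\<close>

lemma higher_deriv_linear_ode:
  fixes f :: "complex \<Rightarrow> complex"
  assumes f: "\<And>t. (f has_field_derivative (\<xi> + t) * f t + c) (at t)"
  shows "(deriv ^^ (n + 2)) f t
    = (\<xi> + t) * (deriv ^^ (n + 1)) f t + of_nat (n + 1) * (deriv ^^ n) f t"
proof (induction n arbitrary: t)
  case 0
  have "deriv f = (\<lambda>t. (\<xi> + t) * f t + c)"
    using f by (auto intro!: DERIV_imp_deriv)
  moreover have "((\<lambda>t. (\<xi> + t) * f t + c) has_field_derivative
      (\<xi> + t) * ((\<xi> + t) * f t + c) + f t) (at t)"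
    by (auto intro!: derivative_eq_intros f)
  ultimately show ?case
    by (simp add: numeral_2_eq_2 DERIV_imp_deriv)
next
  case (Suc n)
  have "f holomorphic_on UNIV"
    using f by (auto simp: holomorphic_on_open)
  then have D: "((deriv ^^ m) f has_field_derivative (deriv ^^ Suc m) f t) (at t)" for m
    using holomorphic_derivI[OF holomorphic_higher_deriv[of f UNIV m] open_UNIV] by simp
  have "((\<lambda>t. (\<xi> + t) * (deriv ^^ (n + 1)) f t + of_nat (n + 1) * (deriv ^^ n) f t)
      has_field_derivative (\<xi> + t) * (deriv ^^ Suc (n + 1)) f t + (deriv ^^ (n + 1)) f t
        + of_nat (n + 1) * (deriv ^^ Suc n) f t) (at t)"
    by (rule derivative_eq_intros D refl | simp del: funpow.simps)+
  moreover have "(deriv ^^ (n + 2)) f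
      = (\<lambda>t. (\<xi> + t) * (deriv ^^ (n + 1)) f t + of_nat (n + 1) * (deriv ^^ n) f t)"
    using Suc by blast
  ultimately have "(deriv ^^ Suc (n + 2)) f t = (\<xi> + t) * (deriv ^^ Suc (n + 1)) f t
      + (deriv ^^ (n + 1)) f t + of_nat (n + 1) * (deriv ^^ Suc n) f t"
    using DERIV_unique D by metis
  then show ?case by (simp add: algebra_simps)
qed

text \<open>At 0 the differentiated equation makes the Taylor coefficients of \<open>f\<close> obey
  the recurrence for \<open>a\<close>. As \<open>f\<close> is entire, its Taylor series converges to
  it at every \<open>t\<close>, so summability needs no estimate on \<open>a\<close>.\<close>

lemma linear_ode_sums:
  fixes f :: "complex \<Rightarrow> complex" and a :: "nat \<Rightarrow> complex"
  assumes f: "\<And>t. (f has_field_derivative (\<xi> + t) * f t + c) (at t)"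
    and a: "a 0 = f 0" "a 1 = \<xi> * f 0 + c"
      "\<And>n. of_nat (n + 2) * a (n + 2) = \<xi> * a (n + 1) + a n"
  shows "(\<lambda>n. a n * t ^ n) sums f t"
proof -
  \<comment> \<open>The recurrence has order two, so the induction carries two consecutive
    coefficients.\<close>
  have coeff: "a n = (deriv ^^ n) f 0 / fact n \<and> a (n + 1) = (deriv ^^ (n + 1)) f 0 / fact (n + 1)"
    for n
  proof (induction n)
    case 0
    then show ?case using a(1,2) DERIV_imp_deriv[OF f[of 0]] by simp
  next
    case (Suc n)
    have "of_nat (n + 2) * a (n + 2)
        = \<xi> * ((deriv ^^ (n + 1)) f 0 / fact (n + 1)) + (deriv ^^ n) f 0 / fact n"
      using a(3)[of n] Suc by simp
    also have "\<dots> = (deriv ^^ (n + 2)) f 0 / fact (n + 1)"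
      unfolding higher_deriv_linear_ode[OF f] by (simp add: field_simps del: funpow.simps of_nat_Suc)
    finally have "a (n + 2) = (deriv ^^ (n + 2)) f 0 / fact (n + 1) / of_nat (n + 2)"
      by (metis add_2_eq_Suc' nonzero_mult_div_cancel_left of_nat_neq_0)
    also have "\<dots> = (deriv ^^ (n + 2)) f 0 / fact (n + 2)"
      by (simp add: divide_divide_eq_left mult.commute del: funpow.simps)
    finally show ?case using Suc by simp
  qed
  have "f holomorphic_on ball 0 (norm t + 1)"
    using f by (auto simp: holomorphic_on_open)
  from holomorphic_power_series[OF this, of t] show ?thesis
    using coeff by simp
qed

theorem theorem3p4:
  fixes \<xi> t :: complex
  shows "summable (Psi_term \<xi> t) \<and>
     summable (Upsilon_term \<xi> t) \<and>
     Psi \<xi> t = exp (\<xi> * t + t\<^sup>2 / 2) \<and>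
     Upsilon \<xi> t =
      exp ((\<xi> + t)\<^sup>2 / 2) * contour_integral (linepath \<xi> (\<xi> + t)) (\<lambda>w. exp (- (w\<^sup>2 / 2))) \<and>
     Upsilon \<xi> t =
      exp (\<xi> * t + t\<^sup>2 / 2) * contour_integral (linepath 0 t) (\<lambda>w. exp (- \<xi> * w - w\<^sup>2 / 2)) \<and>
     Psi \<xi> field_differentiable (at t) \<and>
     deriv (Psi \<xi>) t - \<xi> * Psi \<xi> t = t * Psi \<xi> t \<and>
     Upsilon \<xi> field_differentiable (at t) \<and>
     deriv (Upsilon \<xi>) t - \<xi> * Upsilon \<xi> t = t * Upsilon \<xi> t + 1"
proof -
  let ?p = "\<lambda>n. poly (map_poly of_rat (P_poly n)) \<xi>"
    and ?q = "\<lambda>n. poly (map_poly of_rat (Q_poly n)) \<xi>"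
  note PQ = PQ_system_P_poly_Q_poly
  have init: "?p 0 = 1" "?p 1 = \<xi>" "?q 0 = 0" "?q 1 = 1"
    using PQ PQ_system_1[OF PQ] by (simp_all add: PQ_system_def map_poly_pCons)
  have rec: "of_nat (n + 2) * ev (n + 2) = \<xi> * ev (n + 1) + ev n"
    if "ev = ?p \<or> ev = ?q" for ev n
  proof -
    have "of_nat (n + 2) * poly (map_poly of_rat r) \<xi> =
        \<xi> * poly (map_poly of_rat s) \<xi> + poly (map_poly of_rat u) \<xi>"
      if "of_nat (n + 2) * r = [:0, 1:] * s + u" for r s u :: "rat poly"
    proof -
      \<comment> \<open>Scalar multiplication and \<open>pCons 0\<close> replace the polynomial
        products, since the embedding of coefficients commutes with these forms.\<close>
      have "smult (of_nat (n + 2)) r = pCons 0 s + u"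
        using that by (simp add: of_nat_poly)
      then have "map_poly of_rat (smult (of_nat (n + 2)) r)
          = (map_poly of_rat (pCons 0 s + u) :: complex poly)"
        by (rule arg_cong)
      then have "smult (of_nat (n + 2)) (map_poly of_rat r :: complex poly)
          = pCons 0 (map_poly of_rat s) + map_poly of_rat u"
        by (simp only: map_poly_of_rat_smult map_poly_of_rat_add map_poly_pCons of_rat_0 of_rat_of_nat_eq)
      from arg_cong[OF this, of "\<lambda>p. poly p \<xi>"] show ?thesis by simp
    qed
    then show ?thesis using that PQ_system_recurrence[OF PQ, of n] by blast
  qed

  \<comment> \<open>An entire primitive \<open>K\<close> of the Gaussian turns both contour
    integrals into differences of values of \<open>K\<close>.\<close>
  have "(\<lambda>w :: complex. exp (- (w\<^sup>2 / 2))) holomorphic_on UNIV"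
    by (intro holomorphic_intros) auto
  then obtain K :: "complex \<Rightarrow> complex" where K: "\<And>w. (K has_field_derivative exp (- (w\<^sup>2 / 2))) (at w)"
    using holomorphic_convex_primitive'[of UNIV "\<lambda>w. exp (- (w\<^sup>2 / 2))"]
    by auto
  have K_shift: "((\<lambda>w. K (\<xi> + w)) has_field_derivative exp (- ((\<xi> + w)\<^sup>2 / 2))) (at w)" for w
    using K[of "w + \<xi>"] unfolding DERIV_shift by (simp add: add.commute)
  define \<Phi> where "\<Phi> = (\<lambda>t. exp (\<xi> * t + t\<^sup>2 / 2))"
  define \<Theta> where "\<Theta> = (\<lambda>t. exp ((\<xi> + t)\<^sup>2 / 2) * (K (\<xi> + t) - K \<xi>))"
  have \<Phi>: "(\<Phi> has_field_derivative (\<xi> + t) * \<Phi> t + 0) (at t)" for t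
    unfolding \<Phi>_def by (auto intro!: derivative_eq_intros)
  \<comment> \<open>Variation of constants: the derivative of the \<open>K\<close> factor cancels
    the exponential in front, which leaves the inhomogeneity 1.\<close>
  have \<Theta>: "(\<Theta> has_field_derivative (\<xi> + t) * \<Theta> t + 1) (at t)" for t
    unfolding \<Theta>_def
    by (rule derivative_eq_intros K_shift refl | simp)+ (simp add: exp_minus field_simps)
  have Psi_sums: "Psi_term \<xi> t sums \<Phi> t" for t
    using linear_ode_sums[OF \<Phi>, of ?p t] init rec[of ?p]
    by (simp add: Psi_term_def[abs_def] \<Phi>_def)
  have Upsilon_sums: "Upsilon_term \<xi> t sums \<Theta> t" for t
    using linear_ode_sums[OF \<Theta>, of ?q t] init rec[of ?q]
    by (simp add: Upsilon_term_def[abs_def] \<Theta>_def)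
  \<comment> \<open>The equalities hold as functions of the second argument, so derivatives transfer
    too.\<close>
  have Psi: "Psi \<xi> = \<Phi>" and Upsilon: "Upsilon \<xi> = \<Theta>"
    using Psi_sums Upsilon_sums by (auto simp: Psi_def Upsilon_def sums_iff)

  have "((\<lambda>w. exp (- (w\<^sup>2 / 2))) has_contour_integral K (\<xi> + t) - K \<xi>) (linepath \<xi> (\<xi> + t))"
    using contour_integral_primitive[of UNIV K _ "linepath \<xi> (\<xi> + t)"] K by simp
  then have int1: "contour_integral (linepath \<xi> (\<xi> + t)) (\<lambda>w. exp (- (w\<^sup>2 / 2))) = K (\<xi> + t) - K \<xi>"
    by (rule contour_integral_unique)
  \<comment> \<open>Completing the square makes the second integrand a shifted Gaussian times
    \<open>exp (\<xi>\<^sup>2 / 2)\<close>; the same constant later relates the two exponential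
    prefactors.\<close>
  have "((\<lambda>w. exp (\<xi>\<^sup>2 / 2) * K (\<xi> + w)) has_field_derivative exp (- \<xi> * w - w\<^sup>2 / 2)) (at w)" for w
  proof -
    have "((\<lambda>w. exp (\<xi>\<^sup>2 / 2) * K (\<xi> + w)) has_field_derivative
        exp (\<xi>\<^sup>2 / 2) * exp (- ((\<xi> + w)\<^sup>2 / 2))) (at w)"
      by (rule DERIV_cmult[OF K_shift])
    moreover have "\<xi>\<^sup>2 / 2 + - ((\<xi> + w)\<^sup>2 / 2) = - \<xi> * w - w\<^sup>2 / 2"
      by (simp add: power2_eq_square field_simps)
    ultimately show ?thesis by (simp add: exp_add[symmetric])
  qed
  then have "((\<lambda>w. exp (- \<xi> * w - w\<^sup>2 / 2)) has_contour_integral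
      exp (\<xi>\<^sup>2 / 2) * K (\<xi> + t) - exp (\<xi>\<^sup>2 / 2) * K (\<xi> + 0)) (linepath 0 t)"
    using contour_integral_primitive[of UNIV "\<lambda>w. exp (\<xi>\<^sup>2 / 2) * K (\<xi> + w)" _ "linepath 0 t"]
    by simp
  then have int2: "contour_integral (linepath 0 t) (\<lambda>w. exp (- \<xi> * w - w\<^sup>2 / 2))
      = exp (\<xi>\<^sup>2 / 2) * (K (\<xi> + t) - K \<xi>)"
    by (auto dest!: contour_integral_unique simp: algebra_simps)
  have "exp ((\<xi> + t)\<^sup>2 / 2) = exp (\<xi> * t + t\<^sup>2 / 2) * exp (\<xi>\<^sup>2 / 2)"
    by (simp add: exp_add[symmetric] power2_eq_square field_simps)
  then have "\<Theta> t = exp (\<xi> * t + t\<^sup>2 / 2) * (exp (\<xi>\<^sup>2 / 2) * (K (\<xi> + t) - K \<xi>))"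
    by (simp add: \<Theta>_def)
  moreover have "deriv \<Phi> t = (\<xi> + t) * \<Phi> t" "deriv \<Theta> t = (\<xi> + t) * \<Theta> t + 1"
    using DERIV_imp_deriv[OF \<Phi>] DERIV_imp_deriv[OF \<Theta>] by simp_all
  moreover have "\<Phi> field_differentiable (at t)" "\<Theta> field_differentiable (at t)"
    using \<Phi> \<Theta> field_differentiable_def by blast+
  ultimately show ?thesis
    using Psi_sums[of t] Upsilon_sums[of t] unfolding Psi Upsilon int1 int2
    by (auto simp: sums_iff \<Phi>_def \<Theta>_def algebra_simps)
qed

end
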